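(* Let $A=\{s_i:1\le i\le n\}\subseteq S$, $n\geq 2$, where all sites in $A$ are neighbors of each other under $\partial$. Then the joint probability mass function of $X_{s_1},\dots,X_{s_n}$ (generated in this order) is $$\Pi_{s_1,\dots,s_n}(x_{s_1},\dots,x_{s_n})=\sum_{i=2}^n\Biggl[\Biggl(\frac{\tilde\pi_{s_i}(x_{s_i})(x_{s_i}-\mu_{\tilde\pi_{s_i}})}{\sigma^2_{\tilde\pi_{s_i}}}\sum_{j=1}^{i-1}\ \prod_{k=1,k\ne j}^{i-1}\hat\pi_{s_k}(x_{s_k})\cdot\frac{\beta_{s_i,s_j}\tilde\pi_{s_j}(x_{s_j})(x_{s_j}-\mu_{\tilde\pi_{s_j}})}{\sigma^2_{\tilde\pi_{s_j}}}\Biggr)\cdot\prod_{k=i+1}^n\pi_{s_k}(x_{s_k})\Biggr]+\prod_{i=1}^n\pi_{s_i}(x_{s_i})$$ for each $x_{s_i}\in\mathbf{X}_{s_i}$, $1\le i\le n$.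
   Context: $(S,\partial)$ is a connected finite space of sites with a neighborhood system $\partial$ ($s\notin\partial(s)$; $s\in\partial(t)$ iff $t\in\partial(s)$; $t$ is a neighbor of $s$ if $t\in\partial(s)$). For each $s\in S$, $\mathbf{X}_s$ is a finite set of reals; $\pi_s$ is a strictly positive pmf on $\mathbf{X}_s$, and $\tilde\pi_s,\hat\pi_s$ are two auxiliary pmfs on $\mathbf{X}_s$; $\mu_{\tilde\pi_s}$ and $\sigma^2_{\tilde\pi_s}>0$ are the mean and variance of $\tilde\pi_s$. $\beta_{s_i,s_j}=\beta_{s_j,s_i}$ are real numbers (prescribed covariances). The field on $A$ is generated sequentially in the order $s_1,\dots,s_n$, with base sets $\{s_1,\dots,s_{i-1}\}$, by the conditional probabilities $$\Pi(X_{s_i}=x_{s_i}\mid X_{s_1}=x_{s_1},\dots,X_{s_{i-1}}=x_{s_{i-1}})=\pi_{s_i}(x_{s_i})+\frac{\tilde\pi_{s_i}(x_{s_i})(x_{s_i}-\mu_{\tilde\pi_{s_i}})}{\sigma^2_{\tilde\pi_{s_i}}}\sum_{j=1}^{i-1}\Bigl(\prod_{k<i,k\neq j}\hat\pi_{s_k}(x_{s_k})\Bigr)\frac{\beta_{s_i,s_j}\tilde\pi_{s_j}(x_{s_j})(x_{s_j}-\mu_{\tilde\pi_{s_j}})}{\sigma^2_{\tilde\pi_{s_j}}\,\Pi_{s_1,\dots,s_{i-1}}(x_{s_1},\dots,x_{s_{i-1}})}$$ (assumed to be well defined and in $[0,1]$), so the joint pmfs satisfy $\Pi_{s_1}=\pi_{s_1}$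 and, for $2\le i\le n$, $$\Pi_{s_1,\dots,s_i}(x_{s_1},\dots,x_{s_i})=\Pi_{s_1,\dots,s_{i-1}}(x_{s_1},\dots,x_{s_{i-1}})\,\pi_{s_i}(x_{s_i})+\frac{\tilde\pi_{s_i}(x_{s_i})(x_{s_i}-\mu_{\tilde\pi_{s_i}})}{\sigma^2_{\tilde\pi_{s_i}}}\sum_{j=1}^{i-1}\ \prod_{k=1,k\ne j}^{i-1}\hat\pi_{s_k}(x_{s_k})\cdot\frac{\beta_{s_i,s_j}\tilde\pi_{s_j}(x_{s_j})(x_{s_j}-\mu_{\tilde\pi_{s_j}})}{\sigma^2_{\tilde\pi_{s_j}}}.$$ Empty products equal $1$. *)

theory Defs
  imports "HOL-Probability.Probability"
begin

definition neighborhood_system :: "'s set \<Rightarrow> ('s \<Rightarrow> 's set) \<Rightarrow> bool" where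
  "neighborhood_system S nb \<longleftrightarrow>
     (\<forall>s\<in>S. nb s \<subseteq> S \<and> s \<notin> nb s) \<and>
     (\<forall>s\<in>S. \<forall>t\<in>S. s \<in> nb t \<longleftrightarrow> t \<in> nb s)"

definition connected_sites :: "'s set \<Rightarrow> ('s \<Rightarrow> 's set) \<Rightarrow> bool" where
  "connected_sites S nb \<longleftrightarrow>
     (\<forall>s\<in>S. \<forall>t\<in>S. (s, t) \<in> {(u, v). u \<in> S \<and> v \<in> S \<and> v \<in> nb u}\<^sup>*)"

definition pmf_mean :: "real pmf \<Rightarrow> real" where
  "pmf_mean q = measure_pmf.expectation q (\<lambda>y. y)"

definition pmf_var :: "real pmf \<Rightarrow> real" where
  "pmf_var q = measure_pmf.variance q (\<lambda>y. y)"

text \<open>The factor \<open>\<pi> y * (y - \<mu>) / \<sigma>\<^sup>2\<close> through which covariances enter; on a finite support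
  it sums to zero and has first moment one.\<close>

definition score :: "real pmf \<Rightarrow> real \<Rightarrow> real" where
  "score q y = pmf q y * (y - pmf_mean q) / pmf_var q"

definition joint_pmf :: "'w measure \<Rightarrow> ('s \<Rightarrow> 'w \<Rightarrow> real) \<Rightarrow> 's set \<Rightarrow> ('s \<Rightarrow> real) \<Rightarrow> real" where
  "joint_pmf M X B x = \<P>(\<omega> in M. \<forall>t\<in>B. X t \<omega> = x t)"

text \<open>The prescribed conditional probability of \<open>X (s i) = x (s i)\<close> given the base set
  \<open>s 1, \<dots>, s (i - 1)\<close>. The arguments \<open>p\<close>, \<open>pt\<close>, \<open>ph\<close> are the pmfs written
  \<open>\<pi>\<close>, \<open>\<pi>\<close>-tilde and \<open>\<pi>\<close>-hat on paper.\<close>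

definition cond_formula ::
  "('s \<Rightarrow> real pmf) \<Rightarrow> ('s \<Rightarrow> real pmf) \<Rightarrow> ('s \<Rightarrow> real pmf) \<Rightarrow> ('s \<Rightarrow> 's \<Rightarrow> real) \<Rightarrow>
   'w measure \<Rightarrow> ('s \<Rightarrow> 'w \<Rightarrow> real) \<Rightarrow> (nat \<Rightarrow> 's) \<Rightarrow> nat \<Rightarrow> ('s \<Rightarrow> real) \<Rightarrow> real" where
  "cond_formula p pt ph \<beta> M X s i x =
     pmf (p (s i)) (x (s i)) +
     score (pt (s i)) (x (s i)) *
       (\<Sum>j\<in>{1..<i}. (\<Prod>k\<in>{1..<i} - {j}. pmf (ph (s k)) (x (s k))) *
          (\<beta> (s i) (s j) * score (pt (s j)) (x (s j)) / joint_pmf M X (s ` {1..<i}) x))"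

text \<open>The prescription divides by the joint pmf of the base set, so it has to be well defined.
  At base configurations of probability zero (where Isabelle's division would silently return
  zero and no conditional probability exists) the sum being divided is required to vanish;
  this is exactly what makes the product form
  \<open>joint (i) = joint (i - 1) * \<pi> + \<dots>\<close> hold there too. The requirement is vacuous when all
  base configurations have positive probability.\<close>

definition sequentially_generated ::
  "('s \<Rightarrow> real set) \<Rightarrow> ('s \<Rightarrow> real pmf) \<Rightarrow> ('s \<Rightarrow> real pmf) \<Rightarrow> ('s \<Rightarrow> real pmf) \<Rightarrow>
   ('s \<Rightarrow> 's \<Rightarrow> real) \<Rightarrow> 'w measure \<Rightarrow> ('s \<Rightarrow> 'w \<Rightarrow> real) \<Rightarrow> (nat \<Rightarrow> 's) \<Rightarrow> nat \<Rightarrow> bool" where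
  "sequentially_generated V p pt ph \<beta> M X s n \<longleftrightarrow>
     (\<forall>y\<in>V (s 1). \<P>(\<omega> in M. X (s 1) \<omega> = y) = pmf (p (s 1)) y) \<and>
     (\<forall>i\<in>{2..n}. \<forall>x. (\<forall>k\<in>{1..i}. x (s k) \<in> V (s k)) \<longrightarrow>
        (if joint_pmf M X (s ` {1..<i}) x \<noteq> 0
         then cond_formula p pt ph \<beta> M X s i x \<in> {0..1} \<and>
              \<P>(\<omega> in M. X (s i) \<omega> = x (s i) \<bar> \<forall>t\<in>s ` {1..<i}. X t \<omega> = x t)
                = cond_formula p pt ph \<beta> M X s i x
         else (\<Sum>j\<in>{1..<i}. (\<Prod>k\<in>{1..<i} - {j}. pmf (ph (s k)) (x (s k))) *
                 (\<beta> (s i) (s j) * score (pt (s j)) (x (s j)))) = 0))"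

end

theory Submission
  imports Defs
begin

text \<open>Multiplying the prescribed conditional probability of \<open>X (s i)\<close> by the
  joint pmf of the base set cancels the denominator inside the sum. The joint pmfs J therefore
  satisfy an affine recurrence J(i) = J(i-1) a(i) + b(i), where a(i) is the marginal \<pi> at site
  \<open>s i\<close> and b(i) is the covariance correction, which no longer involves J.
  \<open>joint_pmf_step\<close> proves this recurrence, including at base configurations of
  probability zero. \<open>linear_recurrence_closed_form\<close> unrolls it: each correction b(i) is
  carried forward by the marginals of the later sites, and the initial value a(1) yields the full
  product.\<close>

lemma linear_recurrence_closed_form:
  fixes J a b :: "nat \<Rightarrow> 'a::comm_semiring_1"
  assumes "1 \<le> n" and "J 1 = a 1"
    and "\<And>i. i \<in> {2..n} \<Longrightarrow> J i = J (i - 1) * a i + b i"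
  shows "J n = (\<Sum>i=2..n. b i * (\<Prod>k=i+1..n. a k)) + (\<Prod>i=1..n. a i)"
  using assms
proof (induction n rule: nat_induct_at_least)
  case base
  then show ?case by simp
next
  case (Suc n)
  have IH: "J n = (\<Sum>i=2..n. b i * (\<Prod>k=i+1..n. a k)) + (\<Prod>i=1..n. a i)"
    using Suc by auto
  \<comment> \<open>Each old summand gains the factor \<open>a (Suc n)\<close>; the new top summand
    carries an empty product. It is present because 1 \<le> n puts \<open>Suc n\<close> in the range
    starting at 2.\<close>
  have "(\<Sum>i=2..Suc n. b i * (\<Prod>k=i+1..Suc n. a k))
      = (\<Sum>i=2..n. b i * (\<Prod>k=i+1..n. a k)) * a (Suc n) + b (Suc n)"
    using Suc.hyps by (simp add: sum_distrib_right mult.assoc)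
  moreover have "J (Suc n) = J n * a (Suc n) + b (Suc n)"
    using Suc.prems(2)[of "Suc n"] Suc.hyps by simp
  ultimately show ?case
    by (simp add: IH algebra_simps)
qed

text \<open>A finite intersection of preimages of singletons; \<open>x t\<close> must lie in
  \<open>V t\<close> for its singleton to be measurable in \<open>count_space (V t)\<close>.\<close>

lemma sets_joint_event:
  assumes "finite B" and "\<And>t. t \<in> B \<Longrightarrow> X t \<in> measurable M (count_space (V t))"
    and "\<And>t. t \<in> B \<Longrightarrow> x t \<in> V t"
  shows "{\<omega> \<in> space M. \<forall>t\<in>B. X t \<omega> = x t} \<in> sets M"
proof (rule sets.sets_Collect_finite_All[OF _ \<open>finite B\<close>])
  fix t assume "t \<in> B"
  then have "X t -` {x t} \<inter> space M \<in> sets M"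
    using assms by (intro measurable_sets) auto
  then show "{\<omega> \<in> space M. X t \<omega> = x t} \<in> sets M"
    by (simp add: vimage_def Int_def conj_commute)
qed

text \<open>The chain rule for one new site, with the denominator of \<open>cond_formula\<close>
  cleared. Where the base event is null there is no conditional probability to use, and the
  well-definedness clause of \<open>sequentially_generated\<close> takes over.\<close>

lemma joint_pmf_step:
  assumes "prob_space M" and "sequentially_generated V p pt ph \<beta> M X s n"
    and "i \<in> {2..n}" and V: "\<And>k. k \<in> {1..n} \<Longrightarrow> x (s k) \<in> V (s k)"
    and meas: "\<And>k. k \<in> {1..n} \<Longrightarrow> X (s k) \<in> measurable M (count_space (V (s k)))"
  shows "joint_pmf M X (s ` {1..i}) x
    = joint_pmf M X (s ` {1..i-1}) x * pmf (p (s i)) (x (s i))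
      + score (pt (s i)) (x (s i)) *
         (\<Sum>j\<in>{1..<i}. (\<Prod>k\<in>{1..<i} - {j}. pmf (ph (s k)) (x (s k))) *
            (\<beta> (s i) (s j) * score (pt (s j)) (x (s j))))"
    (is "_ = ?J * _ + _ * ?S")
proof -
  interpret prob_space M by fact
  have base: "{1..<i} = {1..i-1}" and split: "{1..i} = insert i {1..<i}"
    using \<open>i \<in> {2..n}\<close> by auto
  have J: "?J = joint_pmf M X (s ` {1..<i}) x"
    by (simp only: base)
  have gen: "if joint_pmf M X (s ` {1..<i}) x \<noteq> 0
      then cond_formula p pt ph \<beta> M X s i x \<in> {0..1} \<and>
           \<P>(\<omega> in M. X (s i) \<omega> = x (s i) \<bar> \<forall>t\<in>s ` {1..<i}. X t \<omega> = x t)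
             = cond_formula p pt ph \<beta> M X s i x
      else ?S = 0"
  proof -
    have "\<forall>k\<in>{1..i}. x (s k) \<in> V (s k)"
      using \<open>i \<in> {2..n}\<close> V by simp
    then show ?thesis
      using assms(2,3) unfolding sequentially_generated_def by blast
  qed
  have gen_null: "?S = 0" if "?J = 0"
    using gen that by (simp only: J if_False simp_thms)
  have gen_pos: "\<P>(\<omega> in M. X (s i) \<omega> = x (s i) \<bar> \<forall>t\<in>s ` {1..<i}. X t \<omega> = x t)
      = cond_formula p pt ph \<beta> M X s i x" if "?J \<noteq> 0"
    using gen that by (simp only: J if_True simp_thms)
  show ?thesis
  proof (cases "?J = 0")
    case True
    \<comment> \<open>Adding a site shrinks the event, so the left side is zero as well; on the
      right the correction vanishes by \<open>gen_null\<close>.\<close>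
    have "joint_pmf M X (s ` {1..i}) x \<le> ?J"
      unfolding joint_pmf_def
    proof (rule finite_measure_mono)
      show "{\<omega> \<in> space M. \<forall>t\<in>s ` {1..i-1}. X t \<omega> = x t} \<in> sets M"
        using \<open>i \<in> {2..n}\<close> V meas by (intro sets_joint_event[where V = V]) auto
    qed auto
    moreover have "0 \<le> joint_pmf M X (s ` {1..i}) x"
      by (simp add: joint_pmf_def)
    ultimately show ?thesis
      using True gen_null by simp
  next
    case False
    have "joint_pmf M X (s ` {1..i}) x / ?J
        = \<P>(\<omega> in M. X (s i) \<omega> = x (s i) \<bar> \<forall>t\<in>s ` {1..<i}. X t \<omega> = x t)"
      unfolding J split by (simp add: joint_pmf_def cond_prob_def)
    also have "\<dots> = cond_formula p pt ph \<beta> M X s i x"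
      using False by (rule gen_pos)
    \<comment> \<open>The denominator is the same in every summand, so it can be pulled out of the
      sum; multiplying by \<open>?J\<close> then gives the recurrence.\<close>
    also have "\<dots> = pmf (p (s i)) (x (s i)) + score (pt (s i)) (x (s i)) * (?S / ?J)"
      unfolding cond_formula_def J by (simp add: sum_divide_distrib)
    finally show ?thesis
      using False by (simp add: field_simps)
  qed
qed

theorem lemma5p1:
  fixes S A :: "'s set" and nb :: "'s \<Rightarrow> 's set"
    and V :: "'s \<Rightarrow> real set" and p pt ph :: "'s \<Rightarrow> real pmf"
    and \<beta> :: "'s \<Rightarrow> 's \<Rightarrow> real"
    and M :: "'w measure" and X :: "'s \<Rightarrow> 'w \<Rightarrow> real"
    and s :: "nat \<Rightarrow> 's" and n :: nat and x :: "'s \<Rightarrow> real"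
  assumes "finite S" and "neighborhood_system S nb" and "connected_sites S nb"
    and "\<And>t. t \<in> S \<Longrightarrow> finite (V t)"
    and "\<And>t. t \<in> S \<Longrightarrow> set_pmf (p t) = V t"
    and "\<And>t. t \<in> S \<Longrightarrow> set_pmf (pt t) \<subseteq> V t"
    and "\<And>t. t \<in> S \<Longrightarrow> set_pmf (ph t) \<subseteq> V t"
    and "\<And>t. t \<in> S \<Longrightarrow> pmf_var (pt t) > 0"
    and "\<And>t u. t \<in> S \<Longrightarrow> u \<in> S \<Longrightarrow> \<beta> t u = \<beta> u t"
    and "n \<ge> 2" and "inj_on s {1..n}" and "A = s ` {1..n}" and "A \<subseteq> S"
    and "\<And>t u. t \<in> A \<Longrightarrow> u \<in> A \<Longrightarrow> t \<noteq> u \<Longrightarrow> t \<in> nb u"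
    and "prob_space M"
    and "\<And>t. t \<in> A \<Longrightarrow> X t \<in> measurable M (count_space (V t))"
    and "sequentially_generated V p pt ph \<beta> M X s n"
    and "\<And>i. i \<in> {1..n} \<Longrightarrow> x (s i) \<in> V (s i)"
  shows "joint_pmf M X (s ` {1..n}) x =
    (\<Sum>i=2..n.
       (score (pt (s i)) (x (s i)) *
         (\<Sum>j\<in>{1..<i}. (\<Prod>k\<in>{1..<i} - {j}. pmf (ph (s k)) (x (s k))) *
            (\<beta> (s i) (s j) * score (pt (s j)) (x (s j))))) *
       (\<Prod>k=i+1..n. pmf (p (s k)) (x (s k))))
    + (\<Prod>i=1..n. pmf (p (s i)) (x (s i)))"
proof (rule linear_recurrence_closed_form[where J = "\<lambda>i. joint_pmf M X (s ` {1..i}) x"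
      and a = "\<lambda>i. pmf (p (s i)) (x (s i))"])
  show "1 \<le> n"
    using \<open>n \<ge> 2\<close> by simp
  \<comment> \<open>The law of the first site is prescribed only at points of
    \<open>V (s 1)\<close>.\<close>
  have "x (s 1) \<in> V (s 1)"
    using assms(18)[of 1] \<open>n \<ge> 2\<close> by simp
  then show "joint_pmf M X (s ` {1..1}) x = pmf (p (s 1)) (x (s 1))"
    using assms(17) by (simp add: sequentially_generated_def joint_pmf_def)
qed (rule joint_pmf_step[OF assms(15,17)]; use assms(12,16,18) in simp)

end
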